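(* Let $B$ be a finite skew left brace and let $d=|B/\mathrm{Ann}(B)|$. Then $$\frac{2d-1}{d^2}\leqslant \mathrm{Pb}(B)\leqslant\frac{d+1}{2d}.$$
   Context: A skew left brace is a set $B$ with two group structures $(B,+)$ and $(B,\circ)$ (neither assumed abelian) such that $a\circ(b+c)=(a\circ b)-a+(a\circ c)$ for all $a,b,c\in B$, where $-a$ is the inverse of $a$ in $(B,+)$. The identities of the two groups coincide and are denoted by $1$. Put $a*b:=-a+(a\circ b)-b$ and $[a,b]^+:=a+b-a-b$. The annihilator of $B$ is $\mathrm{Ann}(B):=\{a\in B\mid a+b=b+a=a\circ b=b\circ a \text{ for all } b\in B\}$; it is an ideal of $B$, so $B/\mathrm{Ann}(B)$ is a quotient skew brace, and $|B/\mathrm{Ann}(B)|$ is the index of $\mathrm{Ann}(B)$ in $B$. For a finite skew left brace $B$, the commuting probability is $$\mathrm{Pb}(B):=\frac{1}{|B|^2}\,\bigl|\{(a,b)\in B\times B \mid a*b=b*a=[a,b]^+=1\}\bigr|.$$ *)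

theory Defs
  imports Complex_Main "HOL-Algebra.QuotRing"
begin

text \<open>
  A skew left brace is carried by the record type of rings: \<open>\<oplus>\<close> is the additive group
  (written additively, but not assumed abelian) and \<open>\<otimes>\<close> is the group operation \<open>\<circ>\<close>.
\<close>

locale skew_left_brace = group B + add: group "add_monoid B" for B (structure) +
  assumes brace_distrib:
    "\<lbrakk>a \<in> carrier B; b \<in> carrier B; c \<in> carrier B\<rbrakk>
      \<Longrightarrow> a \<otimes> (b \<oplus> c) = (a \<otimes> b) \<ominus> a \<oplus> (a \<otimes> c)"

definition star_op :: "('a, 'm) ring_scheme \<Rightarrow> 'a \<Rightarrow> 'a \<Rightarrow> 'a"
  where "star_op B a b = (\<ominus>\<^bsub>B\<^esub> a) \<oplus>\<^bsub>B\<^esub> (a \<otimes>\<^bsub>B\<^esub> b) \<ominus>\<^bsub>B\<^esub> b"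

definition add_commutator :: "('a, 'm) ring_scheme \<Rightarrow> 'a \<Rightarrow> 'a \<Rightarrow> 'a"
  where "add_commutator B a b = a \<oplus>\<^bsub>B\<^esub> b \<ominus>\<^bsub>B\<^esub> a \<ominus>\<^bsub>B\<^esub> b"

definition Ann :: "('a, 'm) ring_scheme \<Rightarrow> 'a set"
  where "Ann B = {a \<in> carrier B. \<forall>b \<in> carrier B.
    a \<oplus>\<^bsub>B\<^esub> b = b \<oplus>\<^bsub>B\<^esub> a \<and> b \<oplus>\<^bsub>B\<^esub> a = a \<otimes>\<^bsub>B\<^esub> b \<and> a \<otimes>\<^bsub>B\<^esub> b = b \<otimes>\<^bsub>B\<^esub> a}"

definition Pb :: "('a, 'm) ring_scheme \<Rightarrow> real"
  where "Pb B = 1 / (real (order B))\<^sup>2 *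
    real (card {(a, b) \<in> carrier B \<times> carrier B.
      star_op B a b = \<one>\<^bsub>B\<^esub> \<and> star_op B b a = \<one>\<^bsub>B\<^esub> \<and> add_commutator B a b = \<one>\<^bsub>B\<^esub>})"

context skew_left_brace
begin

lemma add_laws:
  assumes "x \<in> carrier B" "y \<in> carrier B" "z \<in> carrier B"
  shows "x \<oplus> y \<in> carrier B" "\<ominus> x \<in> carrier B" "\<zero> \<in> carrier B"
    "(x \<oplus> y) \<oplus> z = x \<oplus> (y \<oplus> z)" "\<zero> \<oplus> x = x" "x \<oplus> \<zero> = x"
    "\<ominus> x \<oplus> x = \<zero>" "x \<oplus> \<ominus> x = \<zero>"
  using assms add.m_closed add.inv_closed add.one_closed add.m_assoc add.l_one add.r_one
    add.l_inv add.r_inv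
  by (simp_all add: a_inv_def)

lemma one_eq_zero: "\<one> = \<zero>"
proof -
  have "\<one> \<otimes> (\<zero> \<oplus> \<zero>) = (\<one> \<otimes> \<zero>) \<ominus> \<one> \<oplus> (\<one> \<otimes> \<zero>)"
    using add.one_closed by (intro brace_distrib) auto
  then have "\<ominus> \<one> = \<zero>"
    using add.one_closed add_laws[of \<zero> \<zero> \<zero>] add_laws[of "\<ominus> \<one>" \<zero> \<zero>] add_laws[of \<one> \<zero> \<zero>]
    by (simp add: a_minus_def)
  then show ?thesis
    using add_laws[of \<one> \<one> \<one>] by simp
qed

lemma Ann_iff:
  "z \<in> Ann B \<longleftrightarrow> z \<in> carrier B \<and>
    (\<forall>b\<in>carrier B. b \<oplus> z = z \<oplus> b \<and> z \<otimes> b = z \<oplus> b \<and> b \<otimes> z = z \<oplus> b)"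
  unfolding Ann_def by (auto; metis)

lemma Ann_subgroup: "subgroup (Ann B) (add_monoid B)"
proof (rule add.subgroupI)
  show "Ann B \<subseteq> carrier (add_monoid B)" by (auto simp: Ann_def)
  have "\<zero> \<in> Ann B"
    unfolding Ann_iff using add_laws one_eq_zero by (metis l_one r_one one_closed)
  then show "Ann B \<noteq> {}" by blast
next
  fix z assume z: "z \<in> Ann B"
  then have zc: "z \<in> carrier B" by (simp add: Ann_def)
  have nc: "\<ominus> z \<in> carrier B" using zc add_laws by blast
  have "b \<oplus> \<ominus> z = \<ominus> z \<oplus> b \<and> \<ominus> z \<otimes> b = \<ominus> z \<oplus> b \<and> b \<otimes> \<ominus> z = \<ominus> z \<oplus> b"
    if b: "b \<in> carrier B" for b
  proof -
    have c: "z \<oplus> x = x \<oplus> z" "z \<otimes> x = z \<oplus> x" "x \<otimes> z = z \<oplus> x" if "x \<in> carrier B" for x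
      using z that by (auto simp: Ann_iff)
    have inv: "inv z = \<ominus> z"
      using c(2)[OF nc] c(3)[OF nc] add_laws[OF zc zc zc] one_eq_zero
      by (metis inv_equality zc nc)
    have cx: "inv z \<otimes> x = \<ominus> z \<oplus> x" if x: "x \<in> carrier B" for x
    proof -
      have k: "\<ominus> z \<oplus> x \<in> carrier B" using nc x add_laws by blast
      have "z \<otimes> (\<ominus> z \<oplus> x) = x"
        using c(2)[OF k] add_laws[OF zc nc x] add_laws[OF x x x] add_laws[OF zc zc zc] by metis
      then show ?thesis using k zc x by (metis inv_solve_left)
    qed
    have cy: "x \<otimes> inv z = \<ominus> z \<oplus> x" if x: "x \<in> carrier B" for x
    proof -
      have k: "\<ominus> z \<oplus> x \<in> carrier B" using nc x add_laws by blast
      have "(\<ominus> z \<oplus> x) \<otimes> z = x"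
        using c(3)[OF k] add_laws[OF zc nc x] add_laws[OF x x x] add_laws[OF zc zc zc] by metis
      then show ?thesis using k zc x by (metis inv_solve_right)
    qed
    have "b \<oplus> \<ominus> z = \<ominus> z \<oplus> b"
    proof -
      have k: "b \<oplus> \<ominus> z \<in> carrier B" using nc b add_laws by blast
      have "z \<oplus> (b \<oplus> \<ominus> z) = b"
        using c(1)[OF k] add_laws[OF b nc zc] add_laws[OF b b b] add_laws[OF zc zc zc] by metis
      then show ?thesis
        using add_laws[OF nc zc k] add_laws[OF k k k] add_laws[OF zc zc zc] by metis
    qed
    then show ?thesis using cx[OF b] cy[OF b] inv by simp
  qed
  then show "inv\<^bsub>add_monoid B\<^esub> z \<in> Ann B"
    using nc unfolding Ann_iff by (simp add: a_inv_def)
next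
  fix z w assume "z \<in> Ann B" "w \<in> Ann B"
  then have zc: "z \<in> carrier B" and wc: "w \<in> carrier B"
    and c: "\<And>x. x \<in> carrier B \<Longrightarrow> x \<oplus> z = z \<oplus> x" "\<And>x. x \<in> carrier B \<Longrightarrow> z \<otimes> x = z \<oplus> x"
      "\<And>x. x \<in> carrier B \<Longrightarrow> x \<otimes> z = z \<oplus> x"
    and d: "\<And>x. x \<in> carrier B \<Longrightarrow> x \<oplus> w = w \<oplus> x" "\<And>x. x \<in> carrier B \<Longrightarrow> w \<otimes> x = w \<oplus> x"
      "\<And>x. x \<in> carrier B \<Longrightarrow> x \<otimes> w = w \<oplus> x"
    by (auto simp: Ann_iff)
  have k: "z \<oplus> w \<in> carrier B" using zc wc add_laws by blast
  have "b \<oplus> (z \<oplus> w) = (z \<oplus> w) \<oplus> b \<and> (z \<oplus> w) \<otimes> b = (z \<oplus> w) \<oplus> b \<and> b \<otimes> (z \<oplus> w) = (z \<oplus> w) \<oplus> b"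
    if b: "b \<in> carrier B" for b
  proof -
    have bw: "b \<oplus> w \<in> carrier B" and wb: "w \<oplus> b \<in> carrier B" and zb: "z \<oplus> b \<in> carrier B"
      using b wc zc add_laws by blast+
    have 1: "b \<oplus> (z \<oplus> w) = (z \<oplus> w) \<oplus> b"
      using add_laws(4)[OF b zc wc] add_laws(4)[OF zc b wc] add_laws(4)[OF zc wc b]
        c(1)[OF b] d(1)[OF b] by simp
    have 2: "(z \<oplus> w) \<otimes> b = (z \<oplus> w) \<oplus> b"
      using m_assoc[OF zc wc b] c(2)[OF wc] d(2)[OF b] c(2)[OF wb] add_laws(4)[OF zc wc b] by simp
    have 3: "b \<otimes> (z \<oplus> w) = (z \<oplus> w) \<oplus> b"
      using m_assoc[OF b zc wc] c(2)[OF wc] c(3)[OF b] d(3)[OF zb] 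
        d(1)[OF zb] add_laws(4)[OF zc wc b] add_laws(4)[OF zc b wc] d(1)[OF b] by simp
    from 1 2 3 show ?thesis by simp
  qed
  then show "z \<otimes>\<^bsub>add_monoid B\<^esub> w \<in> Ann B"
    using k unfolding Ann_iff by simp
qed

lemma Ann_normal: "Ann B \<lhd> add_monoid B"
proof (rule add.normal_invI[OF Ann_subgroup])
  fix x z assume x: "x \<in> carrier (add_monoid B)" and z: "z \<in> Ann B"
  then have "x \<oplus> z = z \<oplus> x" "z \<in> carrier B" by (auto simp: Ann_iff)
  then have "x \<oplus> z \<oplus> \<ominus> x = z"
    using x add_laws(2,4,6,8) by (metis partial_object.select_convs(1))
  then show "x \<otimes>\<^bsub>add_monoid B\<^esub> z \<otimes>\<^bsub>add_monoid B\<^esub> inv\<^bsub>add_monoid B\<^esub> x \<in> Ann B"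
    using z by (simp add: a_inv_def)
qed

lemma quotient_hom:
  assumes x: "x \<in> carrier B" and y: "y \<in> carrier B"
  shows "(Ann B +> x) <+> (Ann B +> y) = Ann B +> (x \<oplus> y)"
    and "[mod Ann B:] (Ann B +> x) \<Otimes> (Ann B +> y) = Ann B +> (x \<otimes> y)"
proof -
  interpret N: normal "Ann B" "add_monoid B" by (rule Ann_normal)
  show "(Ann B +> x) <+> (Ann B +> y) = Ann B +> (x \<oplus> y)"
    using N.rcos_sum[of x y] x y by (simp add: set_add_def a_r_coset_def)
  have ne: "\<zero> \<oplus> u \<in> Ann B +> u" for u
    using N.one_closed by (force simp: a_r_coset_def r_coset_def)
  have mem: "\<exists>z\<in>Ann B. a = z \<oplus> u" if "a \<in> Ann B +> u" for a u
    using that by (auto simp: a_r_coset_def r_coset_def)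
  have eq: "Ann B +> ((z \<oplus> x) \<otimes> (w \<oplus> y)) = Ann B +> (x \<otimes> y)"
    if z: "z \<in> Ann B" and w: "w \<in> Ann B" for z w
  proof -
    have zc: "z \<in> carrier B" and wc: "w \<in> carrier B"
      and c: "\<And>x. x \<in> carrier B \<Longrightarrow> z \<otimes> x = z \<oplus> x"
      and d: "\<And>x. x \<in> carrier B \<Longrightarrow> w \<otimes> x = w \<oplus> x" "\<And>x. x \<in> carrier B \<Longrightarrow> x \<otimes> w = w \<oplus> x"
      using z w by (auto simp: Ann_iff)
    have xy: "x \<otimes> y \<in> carrier B" and zw: "z \<oplus> w \<in> carrier B" and zwA: "z \<oplus> w \<in> Ann B"
      using x y zc wc add_laws N.m_closed[OF z w] by auto
    have "(z \<oplus> x) \<otimes> (w \<oplus> y) = (z \<otimes> x) \<otimes> (w \<otimes> y)"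
      using c[OF x] d(1)[OF y] by simp
    also have "\<dots> = z \<otimes> ((x \<otimes> w) \<otimes> y)"
      using x y zc wc by (simp add: m_assoc)
    also have "x \<otimes> w = w \<otimes> x" using d[OF x] by simp
    also have "z \<otimes> ((w \<otimes> x) \<otimes> y) = z \<otimes> (w \<oplus> (x \<otimes> y))"
      using m_assoc[OF wc x y] d(1)[OF xy] by (rule arg_cong[where f = "(\<otimes>) z", OF trans])
    also have "\<dots> = z \<oplus> (w \<oplus> (x \<otimes> y))"
      using c add_laws(1)[OF wc xy xy] by blast
    also have "\<dots> = (z \<oplus> w) \<oplus> (x \<otimes> y)" using add_laws(4)[OF zc wc xy] by simp
    finally show ?thesis
      using add.coset_mult_assoc[of "Ann B" "z \<oplus> w" "x \<otimes> y"] zw xy zwA N.rcos_const[of "z \<oplus> w"]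
        N.subset
      by (simp add: a_r_coset_def)
  qed
  show "[mod Ann B:] (Ann B +> x) \<Otimes> (Ann B +> y) = Ann B +> (x \<otimes> y)"
  proof -
    have "Ann B +> (a \<otimes> b) = Ann B +> (x \<otimes> y)" if ab: "a \<in> Ann B +> x" "b \<in> Ann B +> y" for a b
    proof -
      obtain z w where "z \<in> Ann B" "w \<in> Ann B" "a = z \<oplus> x" "b = w \<oplus> y"
        using mem[OF ab(1)] mem[OF ab(2)] by blast
      then show ?thesis using eq by simp
    qed
    then have "[mod Ann B:] (Ann B +> x) \<Otimes> (Ann B +> y)
        = (\<Union>a\<in>Ann B +> x. \<Union>b\<in>Ann B +> y. Ann B +> (x \<otimes> y))"
      unfolding rcoset_mult_def by (intro SUP_cong refl)
    then show ?thesis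
      using ne[of x] ne[of y] by auto
  qed
qed

text \<open>
  \<open>Quot\<close> from ring theory, applied to a brace, is the quotient brace: its carrier consists of the
  additive cosets, with both operations induced from representatives.
\<close>

theorem quotient_skew_left_brace: "skew_left_brace (B Quot Ann B)"
proof -
  interpret N: normal "Ann B" "add_monoid B" by (rule Ann_normal)
  let ?Q = "B Quot Ann B" and ?h = "\<lambda>x. Ann B +> x"
  have carr: "carrier ?Q = ?h ` carrier B"
    by (auto simp: FactRing_simps)
  have mult: "?h x \<otimes>\<^bsub>?Q\<^esub> ?h y = ?h (x \<otimes> y)" "?h x \<oplus>\<^bsub>?Q\<^esub> ?h y = ?h (x \<oplus> y)"
    if "x \<in> carrier B" "y \<in> carrier B" for x y
    using quotient_hom[OF that] by (simp_all add: FactRing_def)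
  have hm: "?h \<in> hom B ?Q"
    using mult(1) unfolding hom_def carr by auto
  have ha: "?h \<in> hom (add_monoid B) (add_monoid ?Q)"
    using mult(2) unfolding hom_def by (auto simp: carr)
  have z: "?h \<zero> = Ann B"
    using N.subset by (simp add: a_r_coset_def add.coset_mult_one[simplified])
  have "group (?Q\<lparr>carrier := ?h ` carrier B, one := ?h \<one>\<rparr>)"
    by (rule hom_imp_img_group[OF hm])
  also have "?Q\<lparr>carrier := ?h ` carrier B, one := ?h \<one>\<rparr> = ?Q"
    using carr by (simp add: FactRing_def)
  finally have gm: "group ?Q" .
  have "group ((add_monoid ?Q)\<lparr>carrier := ?h ` carrier B, one := ?h \<zero>\<rparr>)"
    using add.hom_imp_img_group[OF ha] by simp
  also have "(add_monoid ?Q)\<lparr>carrier := ?h ` carrier B, one := ?h \<zero>\<rparr> = add_monoid ?Q"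
    using carr z by (simp add: FactRing_def)
  finally have ga: "group (add_monoid ?Q)" .
  interpret H: group_hom "add_monoid B" "add_monoid ?Q" ?h
    using ga ha add.is_group by (simp add: group_hom_def group_hom_axioms_def)
  have min: "\<ominus>\<^bsub>?Q\<^esub> ?h x = ?h (\<ominus> x)" if "x \<in> carrier B" for x
    using H.hom_inv[of x] that by (simp add: a_inv_def)
  show ?thesis
  proof (intro skew_left_brace.intro skew_left_brace_axioms.intro gm ga)
    fix a b c assume "a \<in> carrier ?Q" "b \<in> carrier ?Q" "c \<in> carrier ?Q"
    then obtain x y v where "x \<in> carrier B" "y \<in> carrier B" "v \<in> carrier B"
      "a = ?h x" "b = ?h y" "c = ?h v" unfolding carr by blast
    moreover have "u \<oplus> w \<in> carrier B" "\<ominus> u \<in> carrier B"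
      if "u \<in> carrier B" "w \<in> carrier B" for u w
      using add_laws that by blast+
    ultimately show "a \<otimes>\<^bsub>?Q\<^esub> (b \<oplus>\<^bsub>?Q\<^esub> c) = (a \<otimes>\<^bsub>?Q\<^esub> b) \<ominus>\<^bsub>?Q\<^esub> a \<oplus>\<^bsub>?Q\<^esub> (a \<otimes>\<^bsub>?Q\<^esub> c)"
      using brace_distrib[of x y v] by (simp add: mult min a_minus_def)
  qed
qed

end

end

theory Submission
  imports Defs
begin

text \<open>
  Say that \<open>a\<close> and \<open>b\<close> commute when \<open>a + b = b + a = a \<circ> b = b \<circ> a\<close>; this is exactly the condition
  counted by \<open>Pb\<close>, and \<open>a\<close> lies in the annihilator iff it commutes with everything.

  Lower bound: every pair with an entry in \<open>Ann B\<close> commutes, and there are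
  \<open>2 |Ann B| |B| - |Ann B|\<^sup>2\<close> such pairs.

  Upper bound: the elements commuting with a fixed \<open>a\<close> need not obviously form a subgroup of either
  group structure, but they are the intersection of three sets each of which is a subgroup of one of
  the two: the additive centralizer of \<open>a\<close>, the multiplicative centralizer of \<open>a\<close>, and the additive
  group of fixed points of \<open>\<lambda>\<^sub>a : b \<mapsto> - a + a \<circ> b\<close>. If \<open>a\<close> is not in the annihilator, one of
  the three is proper, hence by Lagrange has at most \<open>|B| / 2\<close> elements. So the rows indexed by
  \<open>Ann B\<close> contribute \<open>|B|\<close> pairs each and the other rows at most \<open>|B| / 2\<close>.

  Both estimates become functions of \<open>d\<close> through \<open>|B| = d |Ann B|\<close>.
\<close>

lemma (in group) proper_subgroup_card:
  assumes "finite (carrier G)" "subgroup H G" "H \<noteq> carrier G"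
  shows "2 * card H \<le> order G"
proof -
  have sub: "H \<subseteq> carrier G" using assms(2) by (rule subgroup.subset)
  have lag: "card (rcosets H) * card H = order G"
    using assms(2) by (rule lagrange)
  have "card H < order G"
    using sub assms(1,3) by (auto simp: order_def intro: psubset_card_mono)
  then have "card (rcosets H) \<noteq> 0" "card (rcosets H) \<noteq> 1"
    using lag by (metis mult_0 not_less0, metis mult_1 less_irrefl)
  then have "2 \<le> card (rcosets H)" by linarith
  then show ?thesis
    using lag mult_le_mono1 by metis
qed

lemma (in group) element_centralizer_subgroup:
  assumes a: "a \<in> carrier G"
  shows "subgroup {b \<in> carrier G. a \<otimes> b = b \<otimes> a} G"
proof (rule subgroupI)
  show "{b \<in> carrier G. a \<otimes> b = b \<otimes> a} \<noteq> {}" using a by auto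
next
  fix b assume "b \<in> {b \<in> carrier G. a \<otimes> b = b \<otimes> a}"
  then have b: "b \<in> carrier G" "a \<otimes> b = b \<otimes> a" by auto
  have "inv b \<otimes> a = inv b \<otimes> (a \<otimes> b) \<otimes> inv b"
    using a b(1) by (simp add: m_assoc)
  also have "\<dots> = a \<otimes> inv b"
    using a b(1) by (simp add: b(2) m_assoc[symmetric])
  finally show "inv b \<in> {b \<in> carrier G. a \<otimes> b = b \<otimes> a}" using b(1) by simp
next
  fix b c assume "b \<in> {b \<in> carrier G. a \<otimes> b = b \<otimes> a}" "c \<in> {b \<in> carrier G. a \<otimes> b = b \<otimes> a}"
  then show "b \<otimes> c \<in> {b \<in> carrier G. a \<otimes> b = b \<otimes> a}"
    using a by simp (metis m_assoc)
qed auto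

lemma (in group) hom_fixed_points_subgroup:
  assumes h: "h \<in> hom G G"
  shows "subgroup {b \<in> carrier G. h b = b} G"
proof -
  interpret group_hom G G h
    using h by (unfold_locales)
  show ?thesis by (rule subgroupI) (auto intro!: exI[of _ \<one>])
qed

context skew_left_brace
begin

definition commute :: "'a \<Rightarrow> 'a \<Rightarrow> bool"
  where "commute a b \<longleftrightarrow> a \<oplus> b = b \<oplus> a \<and> a \<otimes> b = b \<otimes> a \<and> a \<otimes> b = a \<oplus> b"

lemma add_diff_eq_zero_iff:
  assumes "x \<in> carrier B" "y \<in> carrier B"
  shows "x \<oplus> \<ominus> y = \<zero> \<longleftrightarrow> x = y"
  using assms add_laws by (metis (no_types))

lemma star_op_eq_one_iff:
  assumes a: "a \<in> carrier B" and b: "b \<in> carrier B"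
  shows "star_op B a b = \<one> \<longleftrightarrow> a \<otimes> b = a \<oplus> b"
proof -
  have ab: "a \<otimes> b \<in> carrier B" using a b by simp
  have na: "\<ominus> a \<in> carrier B" using a add_laws by blast
  have "star_op B a b = \<one> \<longleftrightarrow> \<ominus> a \<oplus> a \<otimes> b = b"
    using add_diff_eq_zero_iff[OF add_laws(1)[OF na ab ab] b]
    by (simp add: star_op_def a_minus_def one_eq_zero)
  also have "\<dots> \<longleftrightarrow> a \<otimes> b = a \<oplus> b"
    using add_laws(4)[OF na a b] add_laws(4)[OF a na ab] add_laws[OF a a a]
      add_laws[OF b b b] add_laws[OF ab ab ab] by metis
  finally show ?thesis .
qed

lemma add_commutator_eq_one_iff:
  assumes a: "a \<in> carrier B" and b: "b \<in> carrier B"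
  shows "add_commutator B a b = \<one> \<longleftrightarrow> a \<oplus> b = b \<oplus> a"
proof -
  have ab: "a \<oplus> b \<in> carrier B" and na: "\<ominus> a \<in> carrier B" using a b add_laws by blast+
  have "add_commutator B a b = \<one> \<longleftrightarrow> a \<oplus> b \<oplus> \<ominus> a = b"
    using add_diff_eq_zero_iff[OF add_laws(1)[OF ab na na] b]
    by (simp add: add_commutator_def a_minus_def one_eq_zero)
  also have "\<dots> \<longleftrightarrow> a \<oplus> b = b \<oplus> a"
    using add_laws(4)[OF ab na a] add_laws(4)[OF b a na] add_laws[OF a a a]
      add_laws[OF b b b] add_laws[OF ab ab ab] by metis
  finally show ?thesis .
qed

lemma Pb_eq_commute:
  "Pb B = real (card {(a, b) \<in> carrier B \<times> carrier B. commute a b}) / (real (order B))\<^sup>2"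
proof -
  have "{(a, b) \<in> carrier B \<times> carrier B.
      star_op B a b = \<one> \<and> star_op B b a = \<one> \<and> add_commutator B a b = \<one>}
    = {(a, b) \<in> carrier B \<times> carrier B. commute a b}"
    by (auto simp: star_op_eq_one_iff add_commutator_eq_one_iff commute_def)
  then show ?thesis by (simp add: Pb_def)
qed

lemma Ann_iff_commute: "a \<in> Ann B \<longleftrightarrow> a \<in> carrier B \<and> (\<forall>b\<in>carrier B. commute a b)"
  by (auto simp: Ann_iff commute_def)

lemma commute_sym: "commute a b \<Longrightarrow> commute b a"
  by (auto simp: commute_def)

text \<open>
  After adding \<open>- a\<close> on the left of both sides, the brace law says precisely that \<open>\<lambda>\<^sub>a\<close> is additive.
\<close>

lemma lambda_hom:
  assumes a: "a \<in> carrier B"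
  shows "(\<lambda>b. \<ominus> a \<oplus> a \<otimes> b) \<in> hom (add_monoid B) (add_monoid B)"
proof (rule homI)
  fix b c assume "b \<in> carrier (add_monoid B)" "c \<in> carrier (add_monoid B)"
  then have b: "b \<in> carrier B" and c: "c \<in> carrier B" by auto
  have na: "\<ominus> a \<in> carrier B" using a add_laws by blast
  have ab: "a \<otimes> b \<in> carrier B" and ac: "a \<otimes> c \<in> carrier B" using a b c by auto
  have s: "a \<otimes> b \<oplus> \<ominus> a \<in> carrier B" and t: "\<ominus> a \<oplus> a \<otimes> c \<in> carrier B"
    using na ab ac add_laws by blast+
  show "\<ominus> a \<oplus> a \<otimes> (b \<otimes>\<^bsub>add_monoid B\<^esub> c)
      = (\<ominus> a \<oplus> a \<otimes> b) \<otimes>\<^bsub>add_monoid B\<^esub> (\<ominus> a \<oplus> a \<otimes> c)"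
    using brace_distrib[OF a b c] add_laws(4)[OF na ab t] add_laws(4)[OF ab na ac]
    by (simp add: a_minus_def)
qed (use a add_laws in auto)

lemma lambda_fixed_iff:
  assumes "a \<in> carrier B" "b \<in> carrier B"
  shows "\<ominus> a \<oplus> a \<otimes> b = b \<longleftrightarrow> a \<otimes> b = a \<oplus> b"
  using star_op_eq_one_iff[OF assms] add_diff_eq_zero_iff[of "\<ominus> a \<oplus> a \<otimes> b" b] assms add_laws
  by (simp add: star_op_def a_minus_def one_eq_zero)

text \<open>
  Some \<open>b\<close> fails to commute with \<open>a\<close>, so it is missing from one of the three subgroups described at
  the start; that subgroup is then proper and still contains everything commuting with \<open>a\<close>.
\<close>

lemma card_commute_le_half:
  assumes fin: "finite (carrier B)" and a: "a \<in> carrier B" "a \<notin> Ann B"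
  shows "2 * card {b \<in> carrier B. commute a b} \<le> order B"
proof -
  let ?C = "{b \<in> carrier B. commute a b}"
  have half: "2 * card ?C \<le> order B" if "?C \<subseteq> H" "2 * card H \<le> order B" "H \<subseteq> carrier B" for H
    using that card_mono[of H ?C] finite_subset[OF _ fin] by force
  have order: "order (add_monoid B) = order B" by (simp add: order_def)
  from a obtain b where b: "b \<in> carrier B" "\<not> commute a b"
    by (auto simp: Ann_iff_commute)
  then consider "a \<oplus> b \<noteq> b \<oplus> a" | "a \<otimes> b \<noteq> b \<otimes> a" | "a \<otimes> b \<noteq> a \<oplus> b"
    unfolding commute_def by blast
  then show ?thesis
  proof cases
    case 1
    have "2 * card {b \<in> carrier B. a \<oplus> b = b \<oplus> a} \<le> order B"
      using add.proper_subgroup_card[OF _ add.element_centralizer_subgroup, of a] fin a b 1 order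
      by auto
    then show ?thesis by (rule half[rotated]) (auto simp: commute_def)
  next
    case 2
    have "2 * card {b \<in> carrier B. a \<otimes> b = b \<otimes> a} \<le> order B"
      using proper_subgroup_card[OF _ element_centralizer_subgroup, of a] fin a b 2
      by auto
    then show ?thesis by (rule half[rotated]) (auto simp: commute_def)
  next
    case 3
    have "subgroup {b \<in> carrier B. a \<otimes> b = a \<oplus> b} (add_monoid B)"
      using add.hom_fixed_points_subgroup[OF lambda_hom[OF a(1)]] a(1)
      by (simp add: lambda_fixed_iff cong: conj_cong)
    then have "2 * card {b \<in> carrier B. a \<otimes> b = a \<oplus> b} \<le> order B"
      using add.proper_subgroup_card fin b 3 order by fastforce
    then show ?thesis by (rule half[rotated]) (auto simp: commute_def)
  qed
qed

lemma order_eq_index_times_Ann: "order B = order (B Quot Ann B) * card (Ann B)"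
  using add.lagrange[OF Ann_subgroup]
  by (simp add: order_def FactRing_def A_RCOSETS_def)

lemma commute_pairs_upper:
  assumes fin: "finite (carrier B)"
  shows "2 * card {(a, b) \<in> carrier B \<times> carrier B. commute a b}
    \<le> order B * (order B + card (Ann B))"
proof -
  let ?C = "\<lambda>a. {b \<in> carrier B. commute a b}"
  have sub: "Ann B \<subseteq> carrier B" by (auto simp: Ann_def)
  have "{(a, b) \<in> carrier B \<times> carrier B. commute a b} = (SIGMA a:carrier B. ?C a)" by auto
  then have "2 * card {(a, b) \<in> carrier B \<times> carrier B. commute a b}
      = (\<Sum>a\<in>carrier B. 2 * card (?C a))"
    using fin by (simp add: sum_distrib_left)
  also have "\<dots> \<le> (\<Sum>a\<in>carrier B. order B + (if a \<in> Ann B then order B else 0))"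
  proof (rule sum_mono)
    fix a assume a: "a \<in> carrier B"
    have "card (?C a) \<le> order B"
      unfolding order_def using fin by (intro card_mono) auto
    then show "2 * card (?C a) \<le> order B + (if a \<in> Ann B then order B else 0)"
      using card_commute_le_half[OF fin a] by auto
  qed
  also have "\<dots> = order B * order B + card (carrier B \<inter> Ann B) * order B"
    using fin by (simp add: sum.distrib order_def flip: sum.inter_restrict)
  also have "carrier B \<inter> Ann B = Ann B" using sub by auto
  finally show ?thesis by (simp add: algebra_simps)
qed

text \<open>
  Inclusion-exclusion for the pairs with first entry in \<open>Ann B\<close> and those with second entry there;
  the size of the overlap is moved to the right to avoid truncated subtraction.
\<close>

lemma commute_pairs_lower:
  assumes fin: "finite (carrier B)"
  shows "2 * card (Ann B) * order B
    \<le> card {(a, b) \<in> carrier B \<times> carrier B. commute a b} + (card (Ann B))\<^sup>2"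
proof -
  let ?P = "{(a, b) \<in> carrier B \<times> carrier B. commute a b}"
  let ?L = "Ann B \<times> carrier B" and ?R = "carrier B \<times> Ann B"
  have sub: "Ann B \<subseteq> carrier B" by (auto simp: Ann_def)
  have finA: "finite (Ann B)" using sub fin by (rule finite_subset)
  have "?L \<union> ?R \<subseteq> ?P"
    by (auto simp: Ann_iff_commute intro: commute_sym)
  moreover have "finite ?P" by (rule finite_subset[of _ "carrier B \<times> carrier B"]) (use fin in auto)
  ultimately have "card (?L \<union> ?R) \<le> card ?P" by (rule card_mono[rotated])
  moreover have "card ?L + card ?R = card (?L \<union> ?R) + card (?L \<inter> ?R)"
    using fin finA by (intro card_Un_Int) auto
  moreover have "?L \<inter> ?R = Ann B \<times> Ann B" using sub by auto
  ultimately show ?thesis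
    by (simp add: card_cartesian_product order_def power2_eq_square algebra_simps)
qed

end

theorem proposition3p3:
  fixes B :: "('a, 'm) ring_scheme" and d :: nat
  assumes "skew_left_brace B"
    and "finite (carrier B)"
    and "d = order (B Quot Ann B)"
  shows "(2 * real d - 1) / (real d)\<^sup>2 \<le> Pb B \<and> Pb B \<le> (real d + 1) / (2 * real d)"
proof -
  interpret skew_left_brace B by (rule assms(1))
  define n where "n = real (order B)"
  define z where "z = real (card (Ann B))"
  define p where "p = real (card {(a, b) \<in> carrier B \<times> carrier B. commute a b})"
  have n: "n = real d * z"
    using order_eq_index_times_Ann by (simp add: n_def z_def assms(3))
  have "n > 0" using order_gt_0_iff_finite assms(2) by (simp add: n_def)
  then have d0: "real d > 0" and z0: "z > 0"
    unfolding n by (auto simp: zero_less_mult_iff z_def)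
  have Pb: "Pb B = p / (real d * z)\<^sup>2"
    by (simp add: Pb_eq_commute p_def flip: n n_def)
  have "2 * z * n \<le> p + z\<^sup>2"
    using of_nat_mono[OF commute_pairs_lower[OF assms(2)], where 'a = real]
    by (simp add: n_def z_def p_def)
  then have lower: "(2 * real d - 1) * z\<^sup>2 \<le> p"
    by (simp add: n algebra_simps power2_eq_square)
  have "2 * p \<le> n * (n + z)"
    using of_nat_mono[OF commute_pairs_upper[OF assms(2)], where 'a = real]
    by (simp add: n_def z_def p_def)
  then have upper: "2 * p \<le> real d * (real d + 1) * z\<^sup>2"
    by (simp add: n algebra_simps power2_eq_square)
  have "(2 * real d - 1) / (real d)\<^sup>2 = (2 * real d - 1) * z\<^sup>2 / (real d * z)\<^sup>2"
    using d0 z0 by (simp add: power_mult_distrib)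
  also have "\<dots> \<le> Pb B"
    unfolding Pb using lower by (rule divide_right_mono) simp
  finally have 1: "(2 * real d - 1) / (real d)\<^sup>2 \<le> Pb B" .
  have "Pb B \<le> (real d * (real d + 1) * z\<^sup>2 / 2) / (real d * z)\<^sup>2"
    unfolding Pb using upper by (intro divide_right_mono) auto
  also have "\<dots> = (real d + 1) / (2 * real d)"
    using d0 z0 by (simp add: power2_eq_square)
  finally show ?thesis using 1 by blast
qed

end
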